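(* Let $A,B,C,D,E,G\in\mathbb{C}$, let $k\in\mathbb{N}$ and let $F_0$ be a negative integer. Then $$ F\left(\begin{matrix} A,\;1+A/2,\;B,\;C,\;D,\;E,\;F_0 \\ A/2,\;1+A-B,\;1+A-C,\;1+A-D,\;1+A-E,\;1+A-F_0 \end{matrix}\;\vdots\;\hat{P}_{2k}\right) $$ $$ =\frac{\Gamma(1+A-D)\Gamma(1+A-E)\Gamma(1+A-F_0)\Gamma(1+A-D-E-F_0)}{\Gamma(1+A)\Gamma(1+A-D-F_0)\Gamma(1+A-D-E)\Gamma(1+A-E-F_0)} $$ $$ \times\;{}_{5}F_{4}\left(\begin{matrix} 1+A-B-C-k,\;D,\;E,\;F_0,\;G+k \\ 1+A-B,\;1+A-C,\;D+E+F_0-A,\;G \end{matrix}\right), $$ where $\hat{P}_{2k}$ is the polynomial of degree $2k$ in $t$ given by $$ \hat{P}_{2k}(t)={}_{4}F_{3}\left(\begin{matrix} -k,\;-t,\;t+A,\;B+C+G+k-A-1 \\ B,\;C,\;G \end{matrix}\right). $$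
   Context: ${}_pF_q$ denotes the generalized hypergeometric series evaluated at unit argument. For parameter vectors $\mathbf{a},\mathbf{b}$ and a polynomial $P$, $$F\left(\begin{matrix} \mathbf{a} \\ \mathbf{b} \end{matrix}\;\vdots\;P\right)=\sum_{n\ge0}\frac{\prod_j(a_j)_n}{\prod_j(b_j)_n\,n!}P(n),\qquad (a)_n=\Gamma(a+n)/\Gamma(a).$$ Standing convention: lower parameters are never non-positive integers, and the Gamma functions occurring are not evaluated at poles.
   Formalization: The degree of the polynomial is stated as at most 2k, and exactly 2k when (B+C+G+k-A-1)_k is non-zero; otherwise the degree drops (e.g. k=1, B+C+G=A gives the constant 1). The identity itself needs no such condition. *)

theory Defs
  imports "HOL-Analysis.Analysis"
begin

definition pFq :: "complex list \<Rightarrow> complex list \<Rightarrow> complex" where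
  "pFq as bs = eval_fps (fps_hypergeo as bs 1) 1"

text \<open>The \<open>n\<close>-th coefficient of \<open>fps_hypergeo as bs 1\<close> already contains the factor
  \<open>1 / fact n\<close>.\<close>

definition hyp_poly :: "complex list \<Rightarrow> complex list \<Rightarrow> complex poly \<Rightarrow> complex" where
  "hyp_poly as bs P = (\<Sum>n. fps_nth (fps_hypergeo as bs 1) n * poly P (of_nat n))"

end

(*
Since F0 = -N, all series terminate. Write P_n for the value of P at n. Whipple's transformation
of balanced 4F3 series, itself a consequence of Saalschuetz's theorem applied twice, gives
  (B)_n (C)_n / ((1+A-B)_n (1+A-C)_n) * P_n
    = sum_r (-n)_r (A+n)_r (1+A-B-C-k)_r (G+k)_r / ((1+A-B)_r (1+A-C)_r (G)_r r!).
After interchanging the sums, the inner sum over n is a terminating very-well-poised 5F4 series with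
A, D, E, F0 replaced by A+2r, D+r, E+r, F0+r, which has a closed form.
*)
theory Submission
  imports Defs
begin

section \<open>Non-vanishing and reversal of Pochhammer symbols\<close>

lemma pochhammer_neq_0: "z \<notin> \<int>\<^sub>\<le>\<^sub>0 \<Longrightarrow> pochhammer (z :: 'a :: field_char_0) n \<noteq> 0"
  using pochhammer_eq_0_imp_nonpos_Int by blast

lemma add_of_nat_notin_nonpos_Ints:
  "z \<notin> \<int>\<^sub>\<le>\<^sub>0 \<Longrightarrow> (z :: 'a :: field_char_0) + of_nat n \<notin> \<int>\<^sub>\<le>\<^sub>0"
  using nonpos_Ints_diff_Nats[of "z + of_nat n" "of_nat n"] by auto

lemma notin_nonpos_Ints_add_neq_0:
  "z \<notin> \<int>\<^sub>\<le>\<^sub>0 \<Longrightarrow> (z :: 'a :: field_char_0) + of_nat n \<noteq> 0"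
  using add_of_nat_notin_nonpos_Ints[of z n] by auto

lemma pochhammer_minus_of_nat_fact:
  assumes "s \<le> n"
  shows "pochhammer (- of_nat n) s * fact (n - s) = ((-1) ^ s * fact n :: 'a :: field_char_0)"
proof -
  have "fact n = (pochhammer 1 (n - s) * pochhammer (1 + of_nat (n - s)) s :: 'a)"
    using pochhammer_product[of "n - s" n "1 :: 'a"] assms by (simp add: pochhammer_fact)
  then show ?thesis
    using assms by (simp add: pochhammer_minus pochhammer_fact of_nat_diff algebra_simps)
qed

text \<open>The last \<open>s\<close> factors of \<open>pochhammer x n\<close>, negated and read
  backwards, are the factors of \<open>pochhammer (1 - x - of_nat n) s\<close>. The case
  \<open>s = n\<close> reverses a whole symbol.\<close>

lemma pochhammer_reflect:
  assumes "s \<le> n"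
  shows "pochhammer x (n - s) * pochhammer (1 - x - of_nat n) s =
    ((-1) ^ s * pochhammer x n :: 'a :: field_char_0)"
proof -
  have "pochhammer (1 - x - of_nat n) s = (-1) ^ s * pochhammer (x + of_nat (n - s)) s"
    using assms pochhammer_minus[of "x + of_nat n - 1" s] by (simp add: of_nat_diff algebra_simps)
  moreover have "pochhammer x n = pochhammer x (n - s) * pochhammer (x + of_nat (n - s)) s"
    using pochhammer_product[of "n - s" n x] assms by simp
  ultimately show ?thesis by simp
qed

section \<open>Euler's transformation and Saalschuetz's theorem\<close>

text \<open>Comparison of the \<open>r\<close>-th coefficients in Euler's transformation
  \<open>(1 - z) powr (a + b - g) * F(a, b; g; z) = F(g - a, g - b; g; z)\<close>.\<close>
lemma euler_transformation_coeff:
  fixes a b g :: "'a :: field_char_0"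
  assumes g: "g \<notin> \<int>\<^sub>\<le>\<^sub>0"
  shows "(\<Sum>j\<le>r. pochhammer a j * pochhammer b j / (pochhammer g j * fact j) *
      (pochhammer (g - a - b) (r - j) / fact (r - j))) =
    pochhammer (g - a) r * pochhammer (g - b) r / (pochhammer g r * fact r)"
proof -
  define x where "x = g - a - b"
  define t where "t = (\<lambda>r j. pochhammer a j * pochhammer b j / (pochhammer g j * fact j) *
      (pochhammer x (r - j) / fact (r - j)))"
  define S where "S r = (\<Sum>j\<le>r. t r j)" for r
  have nz: "pochhammer g n \<noteq> 0" "g + of_nat n \<noteq> 0" for n
    using g by (simp_all add: pochhammer_neq_0 notin_nonpos_Ints_add_neq_0)
  txt \<open>Zeilberger recurrence in \<open>r\<close> with certificate \<open>G\<close>.\<close>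
  have R: "(of_nat r + 1) * (g + of_nat r) * S (Suc r) =
      (g - a + of_nat r) * (g - b + of_nat r) * S r" for r
  proof -
    define G where "G j = - of_nat j * (g + of_nat j - 1) * t (Suc r) j" for j
    \<comment> \<open>Passing from row \<open>Suc r\<close> to row \<open>r\<close> keeps the symbol
      in \<open>x\<close>, because \<open>Suc r - Suc j = r - j\<close>; only the ratio of the
      factors in \<open>a\<close>, \<open>b\<close>, \<open>g\<close> and \<open>j\<close>
      enters.\<close>
    have G_Suc: "G (Suc j) = - (a + of_nat j) * (b + of_nat j) * t r j" for j
    proof -
      have "(1 + of_nat j) * (g + of_nat j) * t (Suc r) (Suc j) =
          (a + of_nat j) * (b + of_nat j) * t r j"
        using nz[of j] of_nat_neq_0[of j, where 'a = 'a]
        by (simp add: t_def pochhammer_Suc divide_simps del: of_nat_Suc)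
           (simp add: algebra_simps)
      then show ?thesis by (simp add: G_def algebra_simps)
    qed
    have step: "(of_nat r + 1) * (g + of_nat r) * t (Suc r) j -
        (g - a + of_nat r) * (g - b + of_nat r) * t r j = G (Suc j) - G j" if jr: "j \<le> r" for j
    proof -
      obtain m where m: "r = j + m" using le_Suc_ex[OF jr] by blast
      have "(of_nat m + 1) * t (Suc r) j = (x + of_nat m) * t r j"
      proof -
        have "Suc (j + m) - j = Suc m" by simp
        moreover have "(of_nat m + 1) * (pochhammer x (Suc m) / fact (Suc m)) =
            (x + of_nat m) * (pochhammer x m / fact m)"
          using of_nat_neq_0[of m, where 'a = 'a]
          by (simp add: pochhammer_Suc mult_ac add_ac)
        ultimately show ?thesis
          unfolding t_def m diff_add_inverse mult.left_commute[of "of_nat m + 1"]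
            mult.left_commute[of "x + of_nat m"] by simp
      qed
      \<comment> \<open>Both differences of recurrence and certificate coefficients have the factor
        \<open>g + of_nat r + of_nat j\<close>; their cofactors \<open>of_nat m + 1\<close> and
        \<open>x + of_nat m\<close> are those relating \<open>t (Suc r) j\<close> to
        \<open>t r j\<close>.\<close>
      then have "((of_nat m + 1) * (g + of_nat r + of_nat j)) * t (Suc r) j =
          ((x + of_nat m) * (g + of_nat r + of_nat j)) * t r j"
        by (simp add: mult_ac)
      moreover have "(of_nat r + 1) * (g + of_nat r) - of_nat j * (g + of_nat j - 1) =
          (of_nat m + 1) * (g + of_nat r + of_nat j)"
        by (simp add: m algebra_simps)
      moreover have "(g - a + of_nat r) * (g - b + of_nat r) - (a + of_nat j) * (b + of_nat j) =
          (x + of_nat m) * (g + of_nat r + of_nat j)"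
        by (simp add: m x_def algebra_simps)
      ultimately have "((of_nat r + 1) * (g + of_nat r) - of_nat j * (g + of_nat j - 1)) * t (Suc r) j =
          ((g - a + of_nat r) * (g - b + of_nat r) - (a + of_nat j) * (b + of_nat j)) * t r j"
        by simp
      then show ?thesis
        unfolding G_Suc unfolding G_def by (simp add: algebra_simps)
    qed
    \<comment> \<open>The sum of \<open>t (Suc r) j\<close> stops at \<open>r\<close>: the top term
      missing from \<open>S (Suc r)\<close>, times the weight of the recurrence, is exactly
      \<open>- G (Suc r)\<close>, and \<open>G 0 = 0\<close>.\<close>
    have "(of_nat r + 1) * (g + of_nat r) * (\<Sum>j\<le>r. t (Suc r) j) -
        (g - a + of_nat r) * (g - b + of_nat r) * S r = (\<Sum>j\<le>r. G (Suc j) - G j)"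
      unfolding S_def sum_distrib_left sum_subtractf[symmetric]
      by (rule sum.cong) (simp_all add: step)
    also have "\<dots> = G (Suc r)"
      using sum_lessThan_telescope[of G "Suc r"] by (simp add: G_def lessThan_Suc_atMost)
    finally show ?thesis by (simp add: S_def G_def algebra_simps)
  qed
  have "S r = pochhammer (g - a) r * pochhammer (g - b) r / (pochhammer g r * fact r)"
  proof (induction r)
    case (Suc r)
    have "S (Suc r) = (g - a + of_nat r) * (g - b + of_nat r) * S r / ((of_nat r + 1) * (g + of_nat r))"
      unfolding R[of r, symmetric] using nz(2)[of r] of_nat_neq_0[of r, where 'a = 'a]
      by (simp add: add.commute[of 1])
    then show ?case by (simp add: Suc.IH pochhammer_Suc mult_ac add_ac)
  qed (simp add: S_def t_def)
  then show ?thesis by (simp add: S_def t_def x_def)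
qed

text \<open>By the balancing condition, \<open>c - a - b = 1 - e - of_nat n\<close>. Reflection
  therefore turns \<open>1 / pochhammer e s\<close> into a symbol of index \<open>n - s\<close>, and
  the sum becomes a constant multiple of the convolution in
  \<open>euler_transformation_coeff\<close>.\<close>

lemma saalschuetz:
  fixes a b c e :: "'a :: field_char_0"
  assumes c: "c \<notin> \<int>\<^sub>\<le>\<^sub>0" and e: "e \<notin> \<int>\<^sub>\<le>\<^sub>0" and bal: "c + e = 1 + a + b - of_nat n"
  shows "(\<Sum>s\<le>n. pochhammer (- of_nat n) s * pochhammer a s * pochhammer b s /
      (pochhammer c s * pochhammer e s * fact s)) =
    (-1) ^ n * pochhammer (c - a) n * pochhammer (c - b) n / (pochhammer c n * pochhammer e n)"
proof -
  have x: "c - a - b = 1 - e - of_nat n"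
    using bal by (simp add: algebra_simps)
  have nz: "pochhammer c s \<noteq> 0" "pochhammer e s \<noteq> 0" for s
    using c e by (simp_all add: pochhammer_neq_0)
  have x_n: "pochhammer (c - a - b) n = (-1) ^ n * pochhammer e n"
    using pochhammer_reflect[of n n e] by (simp add: x)
  have "pochhammer (- of_nat n) s * pochhammer a s * pochhammer b s /
      (pochhammer c s * pochhammer e s * fact s) =
    fact n * (-1) ^ n / pochhammer e n * (pochhammer a s * pochhammer b s / (pochhammer c s * fact s) *
      (pochhammer (c - a - b) (n - s) / fact (n - s)))" if "s \<le> n" for s
  proof -
    have "pochhammer (c - a - b) (n - s) * pochhammer e s = (-1) ^ s * ((-1) ^ n * pochhammer e n)"
      using pochhammer_reflect[OF that, of "c - a - b"] by (simp add: x_n) (simp add: x)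
    then have 1: "pochhammer (c - a - b) (n - s) = (-1) ^ s * (-1) ^ n * pochhammer e n / pochhammer e s"
      using nz by (simp add: field_simps)
    have 2: "pochhammer (- of_nat n) s = ((-1) ^ s * fact n / fact (n - s) :: 'a)"
      using pochhammer_minus_of_nat_fact[OF that, where 'a = 'a] by (simp add: field_simps)
    show ?thesis unfolding 1 2 using nz by (simp add: field_simps)
  qed
  then have "(\<Sum>s\<le>n. pochhammer (- of_nat n) s * pochhammer a s * pochhammer b s /
      (pochhammer c s * pochhammer e s * fact s)) = fact n * (-1) ^ n / pochhammer e n *
      (\<Sum>s\<le>n. pochhammer a s * pochhammer b s / (pochhammer c s * fact s) *
      (pochhammer (c - a - b) (n - s) / fact (n - s)))"
    by (simp add: sum_distrib_left)
  then show ?thesis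
    unfolding euler_transformation_coeff[OF c] by (simp add: mult_ac)
qed

section \<open>The terminating very-well-poised 5F4 summation\<close>

text \<open>The very-well-poised quotient of the symbols of \<open>1 + a/2\<close> and
  \<open>a/2\<close> equals \<open>(a + 2 * of_nat m) / a\<close>. Both sides are multiplied by
  \<open>a\<close> to keep this factor polynomial. Creative telescoping gives a first-order
  recurrence in \<open>M\<close>, solved by induction.\<close>

lemma dougall_5F4_terminating:
  fixes a d e :: "'a :: field_char_0"
  assumes a: "1 + a \<notin> \<int>\<^sub>\<le>\<^sub>0" and d: "1 + a - d \<notin> \<int>\<^sub>\<le>\<^sub>0" and e: "1 + a - e \<notin> \<int>\<^sub>\<le>\<^sub>0"
  shows "(\<Sum>m\<le>M. (a + 2 * of_nat m) * pochhammer a m * pochhammer d m * pochhammer e m *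
      pochhammer (- of_nat M) m / (pochhammer (1 + a - d) m * pochhammer (1 + a - e) m *
      pochhammer (1 + a + of_nat M) m * fact m)) =
    a * pochhammer (1 + a) M * pochhammer (1 + a - d - e) M /
      (pochhammer (1 + a - d) M * pochhammer (1 + a - e) M)"
proof -
  define u where "u = (\<lambda>M m. (a + 2 * of_nat m) * pochhammer a m * pochhammer d m * pochhammer e m *
      pochhammer (- of_nat M) m / (pochhammer (1 + a - d) m * pochhammer (1 + a - e) m *
      pochhammer (1 + a + of_nat M) m * fact m))"
  have nz: "pochhammer (1 + a - d) m \<noteq> 0" "pochhammer (1 + a - e) m \<noteq> 0"
    "pochhammer (1 + a + of_nat n) m \<noteq> 0" "1 + a - d + of_nat m \<noteq> 0" "1 + a - e + of_nat m \<noteq> 0"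
    "1 + a + of_nat m \<noteq> 0" for m n
    using a d e
    by (simp_all add: pochhammer_neq_0 notin_nonpos_Ints_add_neq_0 add_of_nat_notin_nonpos_Ints)
  txt \<open>Zeilberger recurrence in \<open>M\<close> with certificate \<open>G\<close>.\<close>
  have R: "(1 + a - d + of_nat M) * (1 + a - e + of_nat M) * (\<Sum>m\<le>Suc M. u (Suc M) m) =
      (1 + a + of_nat M) * (1 + a - d - e + of_nat M) * (\<Sum>m\<le>M. u M m)" for M
  proof -
    \<comment> \<open>The lower symbols have index \<open>m - 1\<close>; the value 0 at
      \<open>m = 0\<close> plays the part of the reciprocal factorial of -1.\<close>
    define G where "G m = (case m of 0 \<Rightarrow> 0 | Suc n \<Rightarrow> pochhammer a m * pochhammer d m * pochhammer e m *
        pochhammer (- of_nat M) n / (pochhammer (1 + a - d) n * pochhammer (1 + a - e) n *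
        pochhammer (2 + a + of_nat M) n * fact n))" for m
    have step: "(1 + a - d + of_nat M) * (1 + a - e + of_nat M) * u (Suc M) m -
        (1 + a + of_nat M) * (1 + a - d - e + of_nat M) * u M m = G (Suc m) - G m" for m
    proof (cases m)
      case 0
      then show ?thesis by (simp add: u_def G_def algebra_simps)
    next
      case (Suc n)
      \<comment> \<open>A common factor of all four terms: once it is pulled out, the telescoping
        identity is one between polynomials. It mixes index \<open>n = m - 1\<close> for
        \<open>- of_nat M\<close> with row \<open>Suc M\<close> for the last lower symbol.\<close>
      define Q where "Q = pochhammer a m * pochhammer d m * pochhammer e m *
        pochhammer (- of_nat M) n / (pochhammer (1 + a - d) m * pochhammer (1 + a - e) m *
        pochhammer (2 + a + of_nat M) m * fact m)"
      have two: "2 + a + of_nat M = 1 + a + of_nat (Suc M)" by simp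
      have nz2: "pochhammer (2 + a + of_nat M) k \<noteq> 0" for k
        unfolding two by (rule nz)
      have nz3: "2 + a + of_nat M + of_nat n \<noteq> 0"
        using nz(6)[of "Suc (M + n)"] by (simp add: add_ac)
      have sh: "pochhammer (1 + a + of_nat M) m =
          (1 + a + of_nat M) * pochhammer (2 + a + of_nat M) m / (2 + a + of_nat M + of_nat n)"
        using nz3 pochhammer_rec[of "1 + a + of_nat M" n] pochhammer_Suc[of "2 + a + of_nat M" n]
        by (simp add: Suc add_ac)
      have m1: "u (Suc M) m = Q * ((a + 2 * of_nat m) * (- of_nat M - 1))"
        using pochhammer_rec[of "- 1 - of_nat M :: 'a" n]
        by (simp add: u_def Q_def Suc two)
      \<comment> \<open>The recurrence coefficient \<open>1 + a + of_nat M\<close> cancels the first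
        factor of \<open>pochhammer (1 + a + of_nat M) m\<close>.\<close>
      have m2: "u M m * (1 + a + of_nat M) =
          Q * ((a + 2 * of_nat m) * (- of_nat M + of_nat n) * (2 + a + of_nat M + of_nat n))"
        unfolding u_def Q_def sh using nz nz2 nz3
        by (simp add: Suc pochhammer_Suc del: of_nat_Suc)
      have m3: "G (Suc m) = Q * ((a + of_nat m) * (d + of_nat m) * (e + of_nat m) * (- of_nat M + of_nat n))"
        using nz nz2 by (simp add: G_def Q_def Suc pochhammer_Suc mult_ac del: of_nat_Suc)
      have m4: "G m = Q * ((1 + a - d + of_nat n) * (1 + a - e + of_nat n) * of_nat m * (2 + a + of_nat M + of_nat n))"
        using nz nz2 nz3 of_nat_neq_0[of n, where 'a = 'a]
        by (simp add: G_def Q_def Suc pochhammer_Suc mult_ac del: of_nat_Suc)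
      have "(1 + a - d + of_nat M) * (1 + a - e + of_nat M) * ((a + 2 * of_nat m) * (- of_nat M - 1)) -
        (1 + a - d - e + of_nat M) * ((a + 2 * of_nat m) * (- of_nat M + of_nat n) * (2 + a + of_nat M + of_nat n)) =
        (a + of_nat m) * (d + of_nat m) * (e + of_nat m) * (- of_nat M + of_nat n) -
        (1 + a - d + of_nat n) * (1 + a - e + of_nat n) * of_nat m * (2 + a + of_nat M + of_nat n)"
        by (simp add: Suc algebra_simps)
      moreover have "(1 + a + of_nat M) * (1 + a - d - e + of_nat M) * u M m =
          (1 + a - d - e + of_nat M) * (u M m * (1 + a + of_nat M))"
        by (simp only: mult_ac)
      ultimately show ?thesis
        unfolding m1 m2 m3 m4 mult.left_commute[of _ Q] by (simp only: right_diff_distrib[symmetric])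
    qed
    \<comment> \<open>Since \<open>pochhammer (- of_nat M) (Suc M) = 0\<close>, both sums can run to
      \<open>Suc M\<close>. The same symbol occurs in \<open>G (Suc (Suc M))\<close>, so the
      telescoped sum vanishes.\<close>
    have "u M (Suc M) = 0"
      by (simp add: u_def pochhammer_of_nat_eq_0_lemma)
    then have "(1 + a - d + of_nat M) * (1 + a - e + of_nat M) * (\<Sum>m\<le>Suc M. u (Suc M) m) -
        (1 + a + of_nat M) * (1 + a - d - e + of_nat M) * (\<Sum>m\<le>M. u M m) =
        (1 + a - d + of_nat M) * (1 + a - e + of_nat M) * (\<Sum>m\<le>Suc M. u (Suc M) m) -
        (1 + a + of_nat M) * (1 + a - d - e + of_nat M) * (\<Sum>m\<le>Suc M. u M m)"
      by simp
    also have "\<dots> = (\<Sum>m\<le>Suc M. G (Suc m) - G m)"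
      unfolding sum_distrib_left sum_subtractf[symmetric] step ..
    also have "\<dots> = G (Suc (Suc M)) - G 0"
      using sum_lessThan_telescope[of G "Suc (Suc M)"] by (simp only: lessThan_Suc_atMost)
    also have "\<dots> = 0"
      by (simp add: G_def pochhammer_of_nat_eq_0_lemma)
    finally show ?thesis by simp
  qed
  have "(\<Sum>m\<le>M. u M m) = a * pochhammer (1 + a) M * pochhammer (1 + a - d - e) M /
      (pochhammer (1 + a - d) M * pochhammer (1 + a - e) M)"
  proof (induction M)
    case (Suc M)
    have "(\<Sum>m\<le>Suc M. u (Suc M) m) = (1 + a + of_nat M) * (1 + a - d - e + of_nat M) *
        (\<Sum>m\<le>M. u M m) / ((1 + a - d + of_nat M) * (1 + a - e + of_nat M))"
      unfolding R[of M, symmetric] using nz by simp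
    then show ?case by (simp only: Suc.IH pochhammer_Suc times_divide_times_eq times_divide_eq_right
        divide_divide_eq_left mult_ac)
  qed (simp add: u_def)
  then show ?thesis by (simp add: u_def)
qed

section \<open>Whipple's transformation of balanced 4F3 series\<close>

text \<open>Each term on the left, with its prefactor, is expanded by Saalschuetz's theorem read
  from right to left. Collecting the double sum along \<open>r = j + s\<close> leaves inner sums
  that are Euler coefficients. \<open>K\<close> is free here; it becomes \<open>- of_nat k\<close>
  later.\<close>

lemma whipple_4F3:
  fixes A B C G K :: "'a :: field_char_0"
  assumes B: "B \<notin> \<int>\<^sub>\<le>\<^sub>0" and C: "C \<notin> \<int>\<^sub>\<le>\<^sub>0" and G: "G \<notin> \<int>\<^sub>\<le>\<^sub>0"
    and AB: "1 + A - B \<notin> \<int>\<^sub>\<le>\<^sub>0" and AC: "1 + A - C \<notin> \<int>\<^sub>\<le>\<^sub>0"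
  shows "pochhammer B n * pochhammer C n / (pochhammer (1 + A - B) n * pochhammer (1 + A - C) n) *
      (\<Sum>j\<le>n. pochhammer K j * pochhammer (- of_nat n) j * pochhammer (of_nat n + A) j *
        pochhammer (B + C + G - K - A - 1) j /
        (pochhammer B j * pochhammer C j * pochhammer G j * fact j)) =
    (\<Sum>r\<le>n. pochhammer (- of_nat n) r * pochhammer (of_nat n + A) r *
        pochhammer (1 + A - B - C + K) r * pochhammer (G - K) r /
        (pochhammer (1 + A - B) r * pochhammer (1 + A - C) r * pochhammer G r * fact r))"
proof -
  define H where "H = B + C + G - K - A - 1"
  define x where "x = 1 + A - B - C"
  have x_eq: "G - K - H = x" by (simp add: H_def x_def)
  \<comment> \<open>Collects what depends on \<open>j\<close> and \<open>s\<close> only through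
    \<open>j + s\<close>, so that it leaves the inner sum after reindexing.\<close>
  define W where "W r = pochhammer (- of_nat n) r * pochhammer (of_nat n + A) r /
    (pochhammer (1 + A - B) r * pochhammer (1 + A - C) r)" for r
  define f where "f j s = pochhammer K j * pochhammer H j / (pochhammer G j * fact j) *
    (pochhammer x s / fact s) * W (j + s)" for j s
  have nz: "pochhammer B m \<noteq> 0" "pochhammer C m \<noteq> 0" "pochhammer G m \<noteq> 0"
    "pochhammer (1 + A - B) m \<noteq> 0" "pochhammer (1 + A - C) m \<noteq> 0" for m
    using assms by (simp_all add: pochhammer_neq_0)
  have step: "pochhammer B n * pochhammer C n / (pochhammer (1 + A - B) n * pochhammer (1 + A - C) n) *
      (pochhammer K j * pochhammer (- of_nat n) j * pochhammer (of_nat n + A) j * pochhammer H j /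
        (pochhammer B j * pochhammer C j * pochhammer G j * fact j)) =
      (\<Sum>s\<le>n-j. f j s)" if jn: "j \<le> n" for j
  proof -
    obtain m where n: "n = j + m" using le_Suc_ex[OF jn] by blast
    define c where "c = 1 + A - B + of_nat j"
    define e where "e = 1 + A - C + of_nat j"
    have ce: "c \<notin> \<int>\<^sub>\<le>\<^sub>0" "e \<notin> \<int>\<^sub>\<le>\<^sub>0"
      using AB AC by (simp_all add: c_def e_def add_of_nat_notin_nonpos_Ints)
    then have nz': "pochhammer c s \<noteq> 0" "pochhammer e s \<noteq> 0" for s
      by (simp_all add: pochhammer_neq_0)
    define S where "S = (\<Sum>s\<le>m. pochhammer (- of_nat m) s * pochhammer (of_nat n + A + of_nat j) s *
        pochhammer x s / (pochhammer c s * pochhammer e s * fact s))"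
    have "S = (-1) ^ m * pochhammer (c - (of_nat n + A + of_nat j)) m * pochhammer (c - x) m /
        (pochhammer c m * pochhammer e m)"
      unfolding S_def by (rule saalschuetz) (use ce in \<open>simp_all add: c_def e_def x_def n\<close>)
    \<comment> \<open>Here \<open>c - (of_nat n + A + of_nat j) = 1 - (B + of_nat j) - of_nat
      m\<close>; reversing the whole symbol yields a sign that cancels the one in Saalschuetz's
      formula.\<close>
    also have "pochhammer (c - (of_nat n + A + of_nat j)) m = (-1) ^ m * pochhammer (B + of_nat j) m"
      using pochhammer_reflect[of m m "B + of_nat j"] by (simp add: c_def n algebra_simps)
    also have "c - x = C + of_nat j"
      by (simp add: c_def x_def)
    finally have S: "S = pochhammer (B + of_nat j) m * pochhammer (C + of_nat j) m /
        (pochhammer c m * pochhammer e m)"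
      by simp
    have f: "f j s = pochhammer K j * pochhammer H j / (pochhammer G j * fact j) * W j *
        (pochhammer (- of_nat m) s * pochhammer (of_nat n + A + of_nat j) s *
        pochhammer x s / (pochhammer c s * pochhammer e s * fact s))" for s
      unfolding f_def W_def pochhammer_product' c_def[symmetric] e_def[symmetric]
      by (simp add: n mult_ac)
    have "(\<Sum>s\<le>n-j. f j s) = pochhammer K j * pochhammer H j / (pochhammer G j * fact j) * W j * S"
      unfolding f S_def sum_distrib_left by (simp add: n)
    also have "pochhammer K j * pochhammer H j / (pochhammer G j * fact j) * W j * S =
      pochhammer B n * pochhammer C n / (pochhammer (1 + A - B) n * pochhammer (1 + A - C) n) *
      (pochhammer K j * pochhammer (- of_nat n) j * pochhammer (of_nat n + A) j * pochhammer H j /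
        (pochhammer B j * pochhammer C j * pochhammer G j * fact j))"
    proof -
      have p: "pochhammer z n = pochhammer z j * pochhammer (z + of_nat j) m" for z :: 'a
        by (simp add: n pochhammer_product')
      show ?thesis
        unfolding p[of B] p[of C] p[of "1 + A - B"] p[of "1 + A - C"] S W_def
          c_def[symmetric] e_def[symmetric]
        using nz nz' by (simp add: mult_ac)
    qed
    finally show ?thesis ..
  qed
  have "pochhammer B n * pochhammer C n / (pochhammer (1 + A - B) n * pochhammer (1 + A - C) n) *
      (\<Sum>j\<le>n. pochhammer K j * pochhammer (- of_nat n) j * pochhammer (of_nat n + A) j *
        pochhammer H j / (pochhammer B j * pochhammer C j * pochhammer G j * fact j)) =
      (\<Sum>j\<le>n. \<Sum>s\<le>n-j. f j s)"
    unfolding sum_distrib_left by (rule sum.cong) (simp_all only: step atMost_iff)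
  also have "\<dots> = (\<Sum>(j, s)\<in>{(j, s). j + s \<le> n}. f j s)"
    by (subst sum.Sigma) (auto intro!: sum.cong)
  also have "\<dots> = (\<Sum>r\<le>n. \<Sum>j\<le>r. f j (r - j))"
    by (rule sum.triangle_reindex_eq)
  also have "\<dots> = (\<Sum>r\<le>n. pochhammer (- of_nat n) r * pochhammer (of_nat n + A) r *
        pochhammer (1 + A - B - C + K) r * pochhammer (G - K) r /
        (pochhammer (1 + A - B) r * pochhammer (1 + A - C) r * pochhammer G r * fact r))"
  proof (rule sum.cong)
    fix r
    \<comment> \<open>The parameter \<open>x\<close> equals \<open>G - K - H\<close>, exactly the
      excess required by Euler's transformation with \<open>a = K\<close>, \<open>b = H\<close>,
      \<open>g = G\<close>.\<close>
    have "(\<Sum>j\<le>r. f j (r - j)) = (\<Sum>j\<le>r. pochhammer K j * pochhammer H j / (pochhammer G j * fact j) *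
        (pochhammer (G - K - H) (r - j) / fact (r - j))) * W r"
      unfolding sum_distrib_right by (rule sum.cong) (simp_all add: f_def x_eq)
    also have "\<dots> = pochhammer (G - K) r * pochhammer (G - H) r / (pochhammer G r * fact r) * W r"
      by (simp only: euler_transformation_coeff[OF G])
    also have "G - H = 1 + A - B - C + K"
      by (simp add: H_def)
    finally show "(\<Sum>j\<le>r. f j (r - j)) = pochhammer (- of_nat n) r * pochhammer (of_nat n + A) r *
        pochhammer (1 + A - B - C + K) r * pochhammer (G - K) r /
        (pochhammer (1 + A - B) r * pochhammer (1 + A - C) r * pochhammer G r * fact r)"
      by (simp add: W_def mult_ac)
  qed simp
  finally show ?thesis by (simp only: H_def)
qed

section \<open>The inner sum after interchanging summations\<close>

text \<open>The factor \<open>pochhammer (- of_nat n) r\<close> removes the terms with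
  \<open>n < r\<close>; with \<open>n = r + m\<close> the rest is a multiple of the sum with shifted
  parameters. The closed form splits into its value at \<open>r = 0\<close> and a quotient of
  symbols of index \<open>r\<close>, which supplies parameters of the final 5F4.\<close>

lemma dougall_5F4_shifted:
  fixes A D E :: "'a :: field_char_0"
  assumes A: "1 + A \<notin> \<int>\<^sub>\<le>\<^sub>0" and D: "1 + A - D \<notin> \<int>\<^sub>\<le>\<^sub>0" and E: "1 + A - E \<notin> \<int>\<^sub>\<le>\<^sub>0"
    and DE: "D + E - of_nat N - A \<notin> \<int>\<^sub>\<le>\<^sub>0" and r: "r \<le> N"
  shows "(\<Sum>n\<le>N. (A + 2 * of_nat n) * pochhammer A n * pochhammer D n * pochhammer E n *
      pochhammer (- of_nat N) n / (pochhammer (1 + A - D) n * pochhammer (1 + A - E) n *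
      pochhammer (1 + A + of_nat N) n * fact n) *
      (pochhammer (- of_nat n) r * pochhammer (of_nat n + A) r)) =
    A * pochhammer (1 + A) N * pochhammer (1 + A - D - E) N /
      (pochhammer (1 + A - D) N * pochhammer (1 + A - E) N) *
    (pochhammer D r * pochhammer E r * pochhammer (- of_nat N) r / pochhammer (D + E - of_nat N - A) r)"
    (is "(\<Sum>n\<le>N. ?f n) = _")
proof -
  obtain M where N: "N = r + M" using le_Suc_ex[OF r] by blast
  define a d e where "a = A + 2 * of_nat r" and "d = D + of_nat r" and "e = E + of_nat r"
  have a1: "1 + a = 1 + A + of_nat (2 * r)" and d1: "1 + a - d = 1 + A - D + of_nat r"
    and e1: "1 + a - e = 1 + A - E + of_nat r" and de1: "1 + a - d - e = 1 + A - D - E"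
    by (simp_all add: a_def d_def e_def)
  have nz: "pochhammer (1 + A - D) m \<noteq> 0" "pochhammer (1 + A - E) m \<noteq> 0"
    "pochhammer (1 + A + of_nat N) m \<noteq> 0" "pochhammer (D + E - of_nat N - A) m \<noteq> 0"
    "pochhammer (1 + a - d) m \<noteq> 0" "pochhammer (1 + a - e) m \<noteq> 0" for m
    unfolding d1 e1 using assms by (simp_all add: pochhammer_neq_0 add_of_nat_notin_nonpos_Ints)
  have ade: "1 + a \<notin> \<int>\<^sub>\<le>\<^sub>0" "1 + a - d \<notin> \<int>\<^sub>\<le>\<^sub>0" "1 + a - e \<notin> \<int>\<^sub>\<le>\<^sub>0"
    unfolding d1 e1 unfolding a1
    using A D E by (simp_all only: add_of_nat_notin_nonpos_Ints not_False_eq_True)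
  \<comment> \<open>The part of the term at \<open>n = r + m\<close> that is free of
    \<open>m\<close>. The sign and the loss of \<open>fact (r + m)\<close> come from reversing
    \<open>pochhammer (- of_nat (r + m)) r\<close>; the two symbols in \<open>A\<close> merge to
    index \<open>2 * r + m\<close> and are split at \<open>2 * r\<close>.\<close>
  define c where "c = (-1) ^ r * pochhammer A (2 * r) * pochhammer D r * pochhammer E r *
    pochhammer (- of_nat N) r / (pochhammer (1 + A - D) r * pochhammer (1 + A - E) r *
      pochhammer (1 + A + of_nat N) r)"
  have "(\<Sum>n\<le>N. ?f n) = (\<Sum>n\<in>{r..N}. ?f n)"
    by (rule sum.mono_neutral_right) (auto simp: pochhammer_of_nat_eq_0_lemma)
  also have "\<dots> = (\<Sum>m\<le>M. ?f (r + m))"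
    by (rule sum.reindex_bij_witness[of _ "\<lambda>m. r + m" "\<lambda>n. n - r"]) (auto simp: N)
  also have "\<dots> = (\<Sum>m\<le>M. c * ((a + 2 * of_nat m) * pochhammer a m * pochhammer d m * pochhammer e m *
      pochhammer (- of_nat M) m / (pochhammer (1 + a - d) m * pochhammer (1 + a - e) m *
      pochhammer (1 + a + of_nat M) m * fact m)))"
  proof (rule sum.cong)
    fix m
    have 1: "pochhammer (- of_nat (r + m)) r = ((-1) ^ r * fact (r + m) / fact m :: 'a)"
      using pochhammer_minus_of_nat_fact[of r "r + m", where 'a = 'a] by (simp add: field_simps)
    have 2: "pochhammer (of_nat (r + m) + A) r * pochhammer A (r + m) =
        pochhammer A (2 * r) * pochhammer a m"
    proof -
      have "r + m + r = 2 * r + m" by simp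
      then have "pochhammer A (r + m) * pochhammer (A + of_nat (r + m)) r =
          pochhammer A (2 * r) * pochhammer (A + of_nat (2 * r)) m"
        by (simp only: pochhammer_product'[symmetric])
      then show ?thesis by (simp add: a_def add_ac mult_ac)
    qed
    have 3: "A + 2 * of_nat (r + m) = a + 2 * of_nat m"
      by (simp add: a_def)
    have 4: "- of_nat N + of_nat r = (- of_nat M :: 'a)"
      "1 + A + of_nat N + of_nat r = 1 + a + of_nat M"
      by (simp_all add: N a_def)
    have "?f (r + m) = (A + 2 * of_nat (r + m)) * pochhammer D (r + m) * pochhammer E (r + m) *
      pochhammer (- of_nat N) (r + m) / (pochhammer (1 + A - D) (r + m) * pochhammer (1 + A - E) (r + m) *
      pochhammer (1 + A + of_nat N) (r + m) * fact (r + m)) * pochhammer (- of_nat (r + m)) r *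
      (pochhammer (of_nat (r + m) + A) r * pochhammer A (r + m))"
      by simp
    also have "\<dots> = c * ((a + 2 * of_nat m) * pochhammer a m * pochhammer d m * pochhammer e m *
      pochhammer (- of_nat M) m / (pochhammer (1 + a - d) m * pochhammer (1 + a - e) m *
      pochhammer (1 + a + of_nat M) m * fact m))"
      unfolding 1 2 3 unfolding pochhammer_product' d1 e1 4 d_def[symmetric] e_def[symmetric] c_def
      by (simp add: mult_ac)
    finally show "?f (r + m) = \<dots>" .
  qed simp
  also have "\<dots> = c * (a * pochhammer (1 + a) M * pochhammer (1 + a - d - e) M /
      (pochhammer (1 + a - d) M * pochhammer (1 + a - e) M))"
    unfolding sum_distrib_left[symmetric]
    by (simp only: dougall_5F4_terminating[OF ade])
  also have "\<dots> = A * pochhammer (1 + A) N * pochhammer (1 + A - D - E) N /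
      (pochhammer (1 + A - D) N * pochhammer (1 + A - E) N) *
    (pochhammer D r * pochhammer E r * pochhammer (- of_nat N) r / pochhammer (D + E - of_nat N - A) r)"
  proof -
    have p: "pochhammer z N = pochhammer z r * pochhammer (z + of_nat r) M" for z :: 'a
      by (simp add: N pochhammer_product')
    \<comment> \<open>The factor \<open>a = A + 2 * of_nat r\<close> joins the neighbouring symbols
      into \<open>pochhammer A (N + r + 1)\<close>. Splitting that anew exposes the symbol of
      \<open>1 + A + of_nat N\<close> that cancels against \<open>c\<close>.\<close>
    have 1: "pochhammer A (2 * r) * (a * pochhammer (1 + a) M) =
        A * (pochhammer (1 + A) N * pochhammer (1 + A + of_nat N) r)"
    proof -
      have "pochhammer A (2 * r) * (a * pochhammer (1 + a) M) = pochhammer A (2 * r + Suc M)"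
        unfolding pochhammer_product' pochhammer_rec by (simp add: a_def add_ac)
      also have "2 * r + Suc M = Suc (N + r)" by (simp add: N)
      also have "pochhammer A (Suc (N + r)) = A * (pochhammer (1 + A) N * pochhammer (1 + A + of_nat N) r)"
        unfolding pochhammer_rec pochhammer_product' by (simp add: add_ac)
      finally show ?thesis .
    qed
    \<comment> \<open>This reflection is the source of the lower parameter
      \<open>D + E + F0 - A\<close> and absorbs the sign in \<open>c\<close>.\<close>
    have 2: "(-1) ^ r * pochhammer (1 + A - D - E) M =
        pochhammer (1 + A - D - E) N / pochhammer (D + E - of_nat N - A) r"
    proof -
      have eq: "1 - (1 + A - D - E) - of_nat N = D + E - of_nat N - A" and M: "N - r = M"
        by (simp_all add: N)
      have "pochhammer (1 + A - D - E) M * pochhammer (D + E - of_nat N - A) r =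
          (-1) ^ r * pochhammer (1 + A - D - E) N"
        using pochhammer_reflect[OF r, of "1 + A - D - E"] unfolding eq M .
      then show ?thesis
        using nz by (simp add: eq_divide_eq mult.assoc)
    qed
    have "c * (a * pochhammer (1 + a) M * pochhammer (1 + a - d - e) M /
        (pochhammer (1 + a - d) M * pochhammer (1 + a - e) M)) =
      (pochhammer A (2 * r) * (a * pochhammer (1 + a) M)) * ((-1) ^ r * pochhammer (1 + A - D - E) M) *
      (pochhammer D r * pochhammer E r * pochhammer (- of_nat N) r) /
      (pochhammer (1 + A - D) N * pochhammer (1 + A - E) N * pochhammer (1 + A + of_nat N) r)"
      unfolding c_def de1 unfolding p[of "1 + A - D"] p[of "1 + A - E"] d1 e1
      by (simp add: mult_ac)
    also have "\<dots> = A * pochhammer (1 + A) N * pochhammer (1 + A - D - E) N /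
      (pochhammer (1 + A - D) N * pochhammer (1 + A - E) N) *
      (pochhammer D r * pochhammer E r * pochhammer (- of_nat N) r / pochhammer (D + E - of_nat N - A) r)"
      unfolding 1 2 using nz by (simp add: mult_ac)
    finally show ?thesis .
  qed
  finally show ?thesis .
qed

section \<open>Terminating series and the polynomial factor\<close>

lemma pFq_terminating:
  assumes "- of_nat N \<in> set as"
  shows "pFq as bs = (\<Sum>n\<le>N. fps_nth (fps_hypergeo as bs 1) n)"
    and "hyp_poly as bs P = (\<Sum>n\<le>N. fps_nth (fps_hypergeo as bs 1) n * poly P (of_nat n))"
proof -
  have 0: "foldr (\<lambda>a r. r * pochhammer a n) as c = 0" if "n > N" for n and c :: complex
    using assms that by (induction as) (auto simp: pochhammer_of_nat_eq_0_lemma)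
  have 1: "fps_nth (fps_hypergeo as bs 1) n = 0" if "n > N" for n
    unfolding fps_hypergeo_nth_alt by (simp add: 0[OF that])
  show "pFq as bs = (\<Sum>n\<le>N. fps_nth (fps_hypergeo as bs 1) n)"
    unfolding pFq_def eval_fps_def by (subst suminf_finite[of "{..N}"]) (auto simp: 1 simp del: fps_hypergeo_nth)
  show "hyp_poly as bs P = (\<Sum>n\<le>N. fps_nth (fps_hypergeo as bs 1) n * poly P (of_nat n))"
    unfolding hyp_poly_def by (subst suminf_finite[of "{..N}"]) (auto simp: 1 simp del: fps_hypergeo_nth)
qed

text \<open>The basis underlying Wilson polynomials, invariant under \<open>t\<close> ->
  \<open>- A - t\<close>. It is built in the polynomial ring so that degrees and leading
  coefficients are available.\<close>

definition wilson_poly :: "'a :: field_char_0 \<Rightarrow> nat \<Rightarrow> 'a poly" where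
  "wilson_poly A j = (\<Prod>i<j. [:of_nat i, -1:] * [:A + of_nat i, 1:])"

lemma poly_wilson_poly:
  "poly (wilson_poly A j) t = pochhammer (- t) j * pochhammer (t + A) j"
  unfolding wilson_poly_def poly_prod pochhammer_prod atLeast0LessThan prod.distrib[symmetric]
  by (rule prod.cong) (simp_all add: algebra_simps)

lemma degree_wilson_poly: "degree (wilson_poly A j) = 2 * j"
  by (induction j) (simp_all add: wilson_poly_def degree_mult_eq del: mult_pCons_left mult_pCons_right)

definition P_hat :: "nat \<Rightarrow> 'a :: field_char_0 \<Rightarrow> 'a \<Rightarrow> 'a \<Rightarrow> 'a \<Rightarrow> 'a poly" where
  "P_hat k A B C G = (\<Sum>j\<le>k. smult (pochhammer (- of_nat k) j *
     pochhammer (B + C + G + of_nat k - A - 1) j /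
     (pochhammer B j * pochhammer C j * pochhammer G j * fact j)) (wilson_poly A j))"

lemma poly_P_hat:
  "poly (P_hat k A B C G) t = (\<Sum>j\<le>k. pochhammer (- of_nat k) j * pochhammer (- t) j *
     pochhammer (t + A) j * pochhammer (B + C + G + of_nat k - A - 1) j /
     (pochhammer B j * pochhammer C j * pochhammer G j * fact j))"
  by (simp add: P_hat_def poly_sum poly_wilson_poly mult_ac)

text \<open>Terms with \<open>j > k\<close> or \<open>j > n\<close> vanish, so the cutoff
  \<open>k\<close> may be exchanged for \<open>n\<close>, the range in
  \<open>whipple_4F3\<close>.\<close>

lemma poly_P_hat_of_nat:
  "poly (P_hat k A B C G) (of_nat n) = (\<Sum>j\<le>n. pochhammer (- of_nat k) j * pochhammer (- of_nat n) j *
     pochhammer (of_nat n + A) j * pochhammer (B + C + G + of_nat k - A - 1) j /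
     (pochhammer B j * pochhammer C j * pochhammer G j * fact j))"
  unfolding poly_P_hat
  by (rule sum.mono_neutral_cong) (auto simp: pochhammer_of_nat_eq_0_lemma)

lemma degree_P_hat_le: "degree (P_hat k A B C G) \<le> 2 * k"
  unfolding P_hat_def
  by (intro degree_sum_le) (auto intro: order.trans[OF degree_smult_le] simp: degree_wilson_poly)

text \<open>Only \<open>j = k\<close> reaches degree \<open>2 * k\<close>. The symbol assumed
  nonzero is the one factor of that leading coefficient which the conditions on \<open>B\<close>,
  \<open>C\<close>, \<open>G\<close> do not control; if it vanishes, the degree drops.\<close>

lemma degree_P_hat:
  assumes "B \<notin> \<int>\<^sub>\<le>\<^sub>0" "C \<notin> \<int>\<^sub>\<le>\<^sub>0" "G \<notin> \<int>\<^sub>\<le>\<^sub>0"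
    and "pochhammer (B + C + G + of_nat k - A - 1) k \<noteq> 0"
  shows "degree (P_hat k A B C G) = 2 * k"
proof (rule antisym[OF degree_P_hat_le le_degree])
  have "coeff (P_hat k A B C G) (2 * k) = pochhammer (- of_nat k) k *
     pochhammer (B + C + G + of_nat k - A - 1) k /
     (pochhammer B k * pochhammer C k * pochhammer G k * fact k) * coeff (wilson_poly A k) (2 * k)"
    unfolding P_hat_def lessThan_Suc_atMost[symmetric] sum.lessThan_Suc
    by (simp add: coeff_sum coeff_eq_0 degree_wilson_poly)
  moreover have "coeff (wilson_poly A k) (2 * k) \<noteq> 0"
    unfolding degree_wilson_poly[of A k, symmetric] leading_coeff_0_iff
    by (simp add: wilson_poly_def del: mult_pCons_left mult_pCons_right)
  ultimately show "coeff (P_hat k A B C G) (2 * k) \<noteq> 0"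
    using assms by (simp add: pochhammer_neq_0 pochhammer_of_nat_eq_0_lemma')
qed

section \<open>Interchange of the two summations and passage to Gamma functions\<close>

theorem mainTheorem18:
  fixes A B C D E G F0 :: complex and k :: nat
  assumes F0: "F0 \<in> \<int>\<^sub>\<le>\<^sub>0" "F0 \<noteq> 0"
    and lower_left: "A/2 \<notin> \<int>\<^sub>\<le>\<^sub>0" "1+A-B \<notin> \<int>\<^sub>\<le>\<^sub>0" "1+A-C \<notin> \<int>\<^sub>\<le>\<^sub>0" "1+A-D \<notin> \<int>\<^sub>\<le>\<^sub>0"
      "1+A-E \<notin> \<int>\<^sub>\<le>\<^sub>0" "1+A-F0 \<notin> \<int>\<^sub>\<le>\<^sub>0"
    and lower_right: "D+E+F0-A \<notin> \<int>\<^sub>\<le>\<^sub>0" "G \<notin> \<int>\<^sub>\<le>\<^sub>0"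
    and lower_P: "B \<notin> \<int>\<^sub>\<le>\<^sub>0" "C \<notin> \<int>\<^sub>\<le>\<^sub>0"
    and Gamma_args: "1+A-D-E-F0 \<notin> \<int>\<^sub>\<le>\<^sub>0" "1+A \<notin> \<int>\<^sub>\<le>\<^sub>0" "1+A-D-F0 \<notin> \<int>\<^sub>\<le>\<^sub>0"
      "1+A-D-E \<notin> \<int>\<^sub>\<le>\<^sub>0" "1+A-E-F0 \<notin> \<int>\<^sub>\<le>\<^sub>0"
  shows "\<exists>P :: complex poly.
    (\<forall>t. poly P t = pFq [- of_nat k, -t, t+A, B + C + G + of_nat k - A - 1] [B, C, G]) \<and>
    degree P \<le> 2*k \<and>
    (pochhammer (B + C + G + of_nat k - A - 1) k \<noteq> 0 \<longrightarrow> degree P = 2*k) \<and>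
    hyp_poly [A, 1+A/2, B, C, D, E, F0] [A/2, 1+A-B, 1+A-C, 1+A-D, 1+A-E, 1+A-F0] P =
      (Gamma (1+A-D) * Gamma (1+A-E) * Gamma (1+A-F0) * Gamma (1+A-D-E-F0)) /
      (Gamma (1+A) * Gamma (1+A-D-F0) * Gamma (1+A-D-E) * Gamma (1+A-E-F0)) *
      pFq [1+A-B-C - of_nat k, D, E, F0, G + of_nat k] [1+A-B, 1+A-C, D+E+F0-A, G]"
proof -
  obtain N where N: "F0 = - of_nat N"
    using F0 by (auto elim: nonpos_Ints_cases')
  have A0: "A \<noteq> 0"
    using lower_left(1) by auto
  define P where "P = P_hat k A B C G"
  \<comment> \<open>\<open>V n\<close> is \<open>A\<close> times the left summand without
    \<open>B\<close>, \<open>C\<close> and \<open>P\<close>; \<open>X r\<close> is the part of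
    Whipple's right-hand side free of \<open>n\<close>; \<open>A * c\<close> is the shifted sum at
    \<open>r = 0\<close>.\<close>
  define V where "V n = (A + 2 * of_nat n) * pochhammer A n * pochhammer D n * pochhammer E n *
      pochhammer (- of_nat N) n / (pochhammer (1 + A - D) n * pochhammer (1 + A - E) n *
      pochhammer (1 + A + of_nat N) n * fact n)" for n
  define X where "X r = pochhammer (1 + A - B - C - of_nat k) r * pochhammer (G + of_nat k) r /
      (pochhammer (1 + A - B) r * pochhammer (1 + A - C) r * pochhammer G r * fact r)" for r
  define c where "c = pochhammer (1 + A) N * pochhammer (1 + A - D - E) N /
      (pochhammer (1 + A - D) N * pochhammer (1 + A - E) N)"
  have well_poised: "pochhammer (1 + A/2) n / pochhammer (A/2) n = (A + 2 * of_nat n) / A" for n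
  proof -
    define h where "h = A/2"
    have A: "A = 2 * h" and h: "h \<noteq> 0" "pochhammer h n \<noteq> 0"
      using A0 pochhammer_neq_0[OF lower_left(1)] by (simp_all add: h_def)
    have "pochhammer h n * (h + of_nat n) = h * pochhammer (1 + h) n"
      unfolding pochhammer_Suc[symmetric] pochhammer_rec by (simp add: add.commute)
    then have "pochhammer (1 + h) n / pochhammer h n = (h + of_nat n) / h"
      using h by (simp add: frac_eq_eq mult.commute)
    also have "\<dots> = (A + 2 * of_nat n) / A"
      unfolding A distrib_left[symmetric]
      by (rule mult_divide_mult_cancel_left[symmetric]) simp
    finally show ?thesis
      by (simp add: h_def)
  qed
  have P_n: "pochhammer B n * pochhammer C n / (pochhammer (1 + A - B) n * pochhammer (1 + A - C) n) *
      poly P (of_nat n) = (\<Sum>r\<le>N. X r * (pochhammer (- of_nat n) r * pochhammer (of_nat n + A) r))"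
    if "n \<le> N" for n
  proof -
    have "pochhammer B n * pochhammer C n / (pochhammer (1 + A - B) n * pochhammer (1 + A - C) n) *
      poly P (of_nat n) = (\<Sum>r\<le>n. X r * (pochhammer (- of_nat n) r * pochhammer (of_nat n + A) r))"
      using whipple_4F3[of B C G A n "- of_nat k"] lower_left lower_right lower_P
      by (simp add: P_def poly_P_hat_of_nat X_def mult_ac)
    \<comment> \<open>The range is padded with zero terms up to \<open>N\<close>, making the double
      sum rectangular and the later swap immediate.\<close>
    also have "\<dots> = (\<Sum>r\<le>N. X r * (pochhammer (- of_nat n) r * pochhammer (of_nat n + A) r))"
      using that by (intro sum.mono_neutral_left) (auto simp: pochhammer_of_nat_eq_0_lemma)
    finally show ?thesis .
  qed
  have "hyp_poly [A, 1+A/2, B, C, D, E, F0] [A/2, 1+A-B, 1+A-C, 1+A-D, 1+A-E, 1+A-F0] P =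
      (\<Sum>n\<le>N. V n / A * (pochhammer B n * pochhammer C n /
        (pochhammer (1 + A - B) n * pochhammer (1 + A - C) n) * poly P (of_nat n)))"
  proof (subst pFq_terminating(2)[of N], goal_cases)
    case 2
    have V: "V n / A = pochhammer A n * (pochhammer (1 + A/2) n / pochhammer (A/2) n) * pochhammer D n *
      pochhammer E n * pochhammer (- of_nat N) n / (pochhammer (1 + A - D) n * pochhammer (1 + A - E) n *
      pochhammer (1 + A + of_nat N) n * fact n)" for n
      unfolding well_poised V_def by (simp add: mult_ac)
    show ?case
      unfolding V by (simp add: N mult_ac)
  qed (simp add: N)
  also have "\<dots> = (\<Sum>n\<le>N. \<Sum>r\<le>N. X r / A * (V n * (pochhammer (- of_nat n) r * pochhammer (of_nat n + A) r)))"
  proof (rule sum.cong)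
    fix n assume "n \<in> {..N}"
    then have n: "n \<le> N" by simp
    show "V n / A * (pochhammer B n * pochhammer C n /
        (pochhammer (1 + A - B) n * pochhammer (1 + A - C) n) * poly P (of_nat n)) =
      (\<Sum>r\<le>N. X r / A * (V n * (pochhammer (- of_nat n) r * pochhammer (of_nat n + A) r)))"
      unfolding P_n[OF n] sum_distrib_left by (simp add: mult_ac)
  qed simp
  also have "\<dots> = (\<Sum>r\<le>N. X r / A * (\<Sum>n\<le>N. V n * (pochhammer (- of_nat n) r * pochhammer (of_nat n + A) r)))"
    unfolding sum_distrib_left by (rule sum.swap)
  also have "\<dots> = (\<Sum>r\<le>N. c * (X r * (pochhammer D r * pochhammer E r * pochhammer (- of_nat N) r /
      pochhammer (D + E - of_nat N - A) r)))"
  proof (rule sum.cong)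
    fix r assume "r \<in> {..N}"
    then have r: "r \<le> N" by simp
    have "(\<Sum>n\<le>N. V n * (pochhammer (- of_nat n) r * pochhammer (of_nat n + A) r)) =
        A * c * (pochhammer D r * pochhammer E r * pochhammer (- of_nat N) r /
          pochhammer (D + E - of_nat N - A) r)"
      unfolding V_def
      by (subst dougall_5F4_shifted) (use lower_left lower_right Gamma_args r in \<open>simp_all add: N c_def\<close>)
    then show "X r / A * (\<Sum>n\<le>N. V n * (pochhammer (- of_nat n) r * pochhammer (of_nat n + A) r)) =
        c * (X r * (pochhammer D r * pochhammer E r * pochhammer (- of_nat N) r /
          pochhammer (D + E - of_nat N - A) r))"
      using A0 by simp
  qed simp
  also have "\<dots> = c * pFq [1+A-B-C - of_nat k, D, E, F0, G + of_nat k] [1+A-B, 1+A-C, D+E+F0-A, G]"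
    by (subst pFq_terminating(1)[of N]) (simp_all add: N X_def sum_distrib_left mult_ac)
  \<comment> \<open>As \<open>F0 = - of_nat N\<close>, each \<open>pochhammer z N\<close> is
    \<open>Gamma (z - F0) / Gamma z\<close>; the pole conditions justify this for all four
    symbols.\<close>
  also have "c = (Gamma (1+A-D) * Gamma (1+A-E) * Gamma (1+A-F0) * Gamma (1+A-D-E-F0)) /
      (Gamma (1+A) * Gamma (1+A-D-F0) * Gamma (1+A-D-E) * Gamma (1+A-E-F0))"
  proof -
    have g: "1 + A - F0 = 1 + A + of_nat N" "1 + A - D - E - F0 = 1 + A - D - E + of_nat N"
      "1 + A - D - F0 = 1 + A - D + of_nat N" "1 + A - E - F0 = 1 + A - E + of_nat N"
      by (simp_all add: N)
    show ?thesis
      unfolding c_def g using lower_left Gamma_args by (simp add: pochhammer_Gamma mult_ac)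
  qed
  finally have main: "hyp_poly [A, 1+A/2, B, C, D, E, F0]
      [A/2, 1+A-B, 1+A-C, 1+A-D, 1+A-E, 1+A-F0] P =
      (Gamma (1+A-D) * Gamma (1+A-E) * Gamma (1+A-F0) * Gamma (1+A-D-E-F0)) /
      (Gamma (1+A) * Gamma (1+A-D-F0) * Gamma (1+A-D-E) * Gamma (1+A-E-F0)) *
      pFq [1+A-B-C - of_nat k, D, E, F0, G + of_nat k] [1+A-B, 1+A-C, D+E+F0-A, G]" .
  have "poly P t = pFq [- of_nat k, -t, t+A, B + C + G + of_nat k - A - 1] [B, C, G]" for t
    by (subst pFq_terminating(1)[of k]) (simp_all add: P_def poly_P_hat)
  moreover have "degree P \<le> 2 * k"
    by (simp add: P_def degree_P_hat_le)
  moreover have "degree P = 2 * k" if "pochhammer (B + C + G + of_nat k - A - 1) k \<noteq> 0"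
    unfolding P_def using degree_P_hat lower_P lower_right that by blast
  ultimately show ?thesis
    using main by blast
qed

end
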